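(* Consider an autonomous system $\dot x=f(x)$ on $\mathcal X\subset\mathbb R^{n+m}$, $f$ continuously differentiable, which is a hierarchical interconnection of a system $a$ (state dimension $n$) and a system $b$ (state dimension $m$), i.e. its Jacobian has the form $$J^{ab}(x)=\begin{bmatrix}J^a(x) & G(x)\\ 0 & J^b(x)\end{bmatrix},\qquad x\in\mathcal X,$$ where $J^a(x)\in\mathbb R^{n\times n}$ and $J^b(x)\in\mathbb R^{m\times m}$ are the Jacobians of systems $a$ and $b$, and $G(x)\in\mathbb R^{n\times m}$ is arbitrary. Write $J_s^a,J_s^b$ for the symmetric parts of $J^a,J^b$, and $\lambda_i^a(x)=\lambda_i(J_s^a(x))$, $\lambda_i^b(x)=\lambda_i(J_s^b(x))$. Assume that one of the two systems $a$, $b$ (either one) is weakly contracting and the other is contracting; that is, either $\lambda_1^a(x)+\lambda_2^a(x)<0$ and $\lambda_1^b(x)<0$ for all $x\in\mathcal X$ (with $n\ge2$), or $\lambda_1^b(x)+\lambda_2^b(x)<0$ and $\lambda_1^a(x)<0$ for all $x\in\mathcal X$ (with $m\ge2$). If $\lambda_1^a(x)+\lambda_1^b(x)<0$ for all $x\in\mathcal X$, then the hierarchical interconnection is weakly contracting, i.e. there exists a constant nonsingular matrix $\Theta\in\mathbb R^{(n+m)\times(n+m)}$ such that $$S_2\big(\Theta J^{ab}(x)\Theta^{-1}+(\Theta J^{ab}(x)\Theta^{-1})'\big)<0\quad\text{for all }x\in\mathcal X.$$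
   Context: Primes denote transpose; the symmetric part of a square matrix $J$ is $J_s=\tfrac12(J+J')$. For a symmetric matrix $H$, $\lambda_1(H)\ge\lambda_2(H)\ge\cdots$ denote its eigenvalues in non-increasing order, counted with multiplicity, and $S_2(H)=\lambda_1(H)+\lambda_2(H)$. Systems are considered on a compact, simply-connected, strictly forward-invariant set $\mathcal X$ (any solution starting on the boundary of $\mathcal X$ at $t=0$ remains in the interior of $\mathcal X$ afterwards); it is assumed that the interconnected system does not leave the set $\mathcal X$ on which the stated conditions hold. A system with Jacobian $J$ is weakly contracting if $\lambda_1(J_s(x))+\lambda_2(J_s(x))<0$ for all $x$, and is also called weakly contracting if there is a constant nonsingular matrix $\Theta$ with $S_2(\Theta J(x)\Theta^{-1}+(\Theta J(x)\Theta^{-1})')<0$ for all $x$; it is contracting (in the identity metric) if $\lambda_1(J_s(x))<0$ for all $x$. *)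

theory Defs
  imports
    "HOL-Analysis.Analysis"
    "HOL-Computational_Algebra.Polynomial"
    "HOL-Library.Multiset"
begin

text \<open>Real eigenvalues are taken as the roots of \<open>det (X I - A)\<close> with algebraic multiplicity.
  For symmetric \<open>A\<close> all roots are real, so \<open>eigvals_desc A\<close> then has length \<open>CARD('n)\<close>.\<close>

definition charpoly :: "real^'n^'n \<Rightarrow> real poly" where
  "charpoly A = det (\<chi> i j. (if i = j then [:0, 1:] else 0) - [:A $ i $ j:])"

definition eigvals_desc :: "real^'n^'n \<Rightarrow> real list" where
  "eigvals_desc A = rev (sorted_list_of_multiset (proots (charpoly A)))"

text \<open>The index \<open>k\<close> is 1-based; \<open>eigval k H\<close> is meaningful for symmetric \<open>H\<close> and
  \<open>1 \<le> k \<le> CARD('n)\<close>, and unspecified outside that range.\<close>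

definition eigval :: "nat \<Rightarrow> real^'n^'n \<Rightarrow> real" where
  "eigval k H = eigvals_desc H ! (k - 1)"

definition S2 :: "real^'n^'n \<Rightarrow> real" where
  "S2 H = eigval 1 H + eigval 2 H"

definition sym_part :: "real^'n^'n \<Rightarrow> real^'n^'n" where
  "sym_part J = (1/2) *\<^sub>R (J + transpose J)"

text \<open>\<open>real^('n + 'm)\<close> is the state space of dimension n + m: components \<open>Inl i\<close>
  belong to the first subsystem, components \<open>Inr j\<close> to the second.\<close>

definition block_matrix ::
  "real^'n^'n \<Rightarrow> real^'m^'n \<Rightarrow> real^'n^'m \<Rightarrow> real^'m^'m \<Rightarrow> real^('n + 'm)^('n + 'm)" where
  "block_matrix A B C D = (\<chi> r c.
     (case r of
        Inl i \<Rightarrow> (case c of Inl k \<Rightarrow> A $ i $ k | Inr l \<Rightarrow> B $ i $ l)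
      | Inr j \<Rightarrow> (case c of Inl k \<Rightarrow> C $ j $ k | Inr l \<Rightarrow> D $ j $ l)))"

definition C1_on :: "(real^'k \<Rightarrow> real^'k) \<Rightarrow> (real^'k) set \<Rightarrow> bool" where
  "C1_on f U \<longleftrightarrow> (\<forall>x\<in>U. f differentiable (at x)) \<and> continuous_on U (\<lambda>x. jacobian f (at x))"

definition ode_solution ::
  "('a::real_normed_vector \<Rightarrow> 'a) \<Rightarrow> 'a set \<Rightarrow> real \<Rightarrow> (real \<Rightarrow> 'a) \<Rightarrow> bool" where
  "ode_solution f U T x \<longleftrightarrow>
     (\<forall>t\<in>{0..<T}. x t \<in> U \<and> (x has_vector_derivative f (x t)) (at t within {0..<T}))"

definition forward_invariant ::
  "('a::real_normed_vector \<Rightarrow> 'a) \<Rightarrow> 'a set \<Rightarrow> 'a set \<Rightarrow> bool" where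
  "forward_invariant f U X \<longleftrightarrow>
     (\<forall>T>0. \<forall>x. ode_solution f U T x \<and> x 0 \<in> X \<longrightarrow> (\<forall>t\<in>{0..<T}. x t \<in> X))"

definition strictly_forward_invariant ::
  "('a::real_normed_vector \<Rightarrow> 'a) \<Rightarrow> 'a set \<Rightarrow> 'a set \<Rightarrow> bool" where
  "strictly_forward_invariant f U X \<longleftrightarrow>
     (\<forall>T>0. \<forall>x. ode_solution f U T x \<and> x 0 \<in> frontier X \<longrightarrow> (\<forall>t\<in>{0<..<T}. x t \<in> interior X))"

end

theory Submission
  imports Defs
begin

text \<open>For a symmetric matrix \<open>H\<close>, the sum of the two largest eigenvalues is the maximum of
  \<open>u \<bullet> H u + v \<bullet> H v\<close> over orthonormal pairs \<open>u, v\<close> (Ky Fan).  So weak contraction is a strict inequality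
  between quadratic forms, required at all points of \<open>X\<close> and for all orthonormal pairs.

  Without the coupling \<open>G\<close> the interconnection is block diagonal, and its eigenvalues are those of the two
  symmetric parts together.  Two of them belong both to system \<open>a\<close>, both to system \<open>b\<close>, or one to each.
  The first two kinds have negative sum because each system is contracting or weakly contracting, the mixed
  kind because of the cross condition (\<open>block_diagonal_trace_on_plane_neg\<close>, by way of
  \<open>trace_on_plane_neg\<close>).

  The coupling is made harmless by the change of coordinates \<open>\<Theta> = diag(I, I / \<epsilon>)\<close>: because the lower left
  block vanishes, conjugation by \<open>\<Theta>\<close> replaces \<open>G\<close> by \<open>\<epsilon> G\<close> and leaves the diagonal blocks alone
  (\<open>block_matrix_scaling_conjugation\<close>).  A single \<open>\<epsilon>\<close> serves all \<open>x\<close>, since the Jacobian is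
  continuous and the set of points of \<open>X\<close> paired with orthonormal pairs is compact
  (\<open>compact_uniform_perturbation\<close>).  The inequality between quadratic forms is finally turned back into one
  about eigenvalues by \<open>S2_neg_if_trace_on_planes_neg\<close>.

  The eigenvalues of the statement are roots of the characteristic polynomial listed with
  multiplicity.  They are linked to quadratic forms by the spectral theorem
  (\<open>symmetric_matrix_diagonalization\<close>): the diagonal entries of a diagonalization are these roots, and
  a pair of positions in the sorted list is a pair of distinct indices (\<open>eigvals_desc_diagonalized\<close>).\<close>

section \<open>Orthogonal diagonalization of symmetric matrices\<close>

lemma symmetric_matrix_inner:
  fixes A :: "real^'n^'n"
  assumes "transpose A = A"
  shows "x \<bullet> (A *v y) = (A *v x) \<bullet> y"
  by (metis assms dot_lmul_matrix transpose_matrix_vector)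

text \<open>The Rayleigh quotient: the quadratic form of \<open>A\<close> attains its maximum over the unit sphere of \<open>S\<close>,
  and a maximiser is an eigenvector.  Invariance of \<open>S\<close> puts the residual \<open>A u - l u\<close> inside \<open>S\<close>,
  where it can serve as a direction of variation.\<close>

lemma symmetric_matrix_eigenvector_in_subspace:
  fixes A :: "real^'n^'n"
  assumes sym: "transpose A = A" and S: "subspace S"
    and inv: "\<And>x. x \<in> S \<Longrightarrow> A *v x \<in> S"
    and "a \<in> S" "a \<noteq> 0"
  obtains u l where "u \<in> S" "norm u = 1" "A *v u = l *\<^sub>R u"
proof -
  let ?K = "sphere 0 1 \<inter> S"
  have "compact ?K"
    using S by (simp add: closed_subspace compact_Int_closed)
  moreover have "(1 / norm a) *\<^sub>R a \<in> ?K"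
    using assms by (simp add: subspace_scale)
  moreover have "continuous_on ?K (\<lambda>x. x \<bullet> (A *v x))"
    by (intro continuous_intros linear_continuous_on matrix_vector_mul_bounded_linear)
  ultimately have "\<exists>u\<in>?K. \<forall>y\<in>?K. y \<bullet> (A *v y) \<le> u \<bullet> (A *v u)"
    by (intro continuous_attains_sup) blast+
  then obtain u where u: "u \<in> ?K" and max: "\<And>y. y \<in> ?K \<Longrightarrow> y \<bullet> (A *v y) \<le> u \<bullet> (A *v u)"
    by blast
  define l where "l = u \<bullet> (A *v u)"
  have uu: "u \<bullet> u = 1"
    using u by (simp add: dot_square_norm)
  have bound: "v \<bullet> (A *v v) \<le> l * (v \<bullet> v)" if "v \<in> S" for v
  proof (cases "v = 0")
    case False
    define y where "y = (1 / norm v) *\<^sub>R v"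
    have "y \<in> ?K"
      using S that False by (simp add: y_def subspace_scale)
    then have "y \<bullet> (A *v y) \<le> l"
      using max by (simp add: l_def)
    then have "(v \<bullet> (A *v v)) / (norm v * norm v) \<le> l"
      by (simp add: y_def matrix_vector_mult_scaleR)
    then show ?thesis
      using False by (simp add: divide_le_eq dot_square_norm power2_eq_square)
  qed simp
  define w where "w = A *v u - l *\<^sub>R u"
  have wS: "w \<in> S"
    unfolding w_def using S inv u by (simp add: subspace_diff subspace_scale)
  have uw: "u \<bullet> w = 0"
    by (simp add: w_def inner_diff_right uu l_def)
  have wA: "w \<bullet> (A *v u) = w \<bullet> w"
    using uw by (simp add: w_def inner_diff_right inner_diff_left inner_commute)
  define q where "q = l * (w \<bullet> w) - w \<bullet> (A *v w)"
  \<comment> \<open>Stationarity: perturbing the maximiser \<open>u\<close> by \<open>t w\<close> changes the quadratic form by \<open>2 t |w|\<^sup>2\<close>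
      to first order, which would beat the maximum for small \<open>t > 0\<close> unless the residual \<open>w\<close> vanishes.\<close>
  have ineq: "2 * t * (w \<bullet> w) \<le> t\<^sup>2 * q" for t
  proof -
    have "u + t *\<^sub>R w \<in> S"
      using S u wS by (simp add: subspace_add subspace_scale)
    from bound[OF this] show ?thesis
      using uw wA uu symmetric_matrix_inner[OF sym, of u w]
      by (simp add: matrix_vector_right_distrib matrix_vector_mult_scaleR inner_add_left inner_add_right
          inner_commute l_def[symmetric] q_def power2_eq_square algebra_simps)
  qed
  have "w \<bullet> w = 0"
  proof (rule ccontr)
    assume "w \<bullet> w \<noteq> 0"
    then have pos: "w \<bullet> w > 0"
      by (simp add: order_less_le)
    define t where "t = (w \<bullet> w) / (\<bar>q\<bar> + 1)"
    have t: "t > 0"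
      using pos by (simp add: t_def)
    have "t * q \<le> t * (\<bar>q\<bar> + 1)"
      using t by (intro mult_left_mono) auto
    also have "\<dots> = w \<bullet> w"
      by (simp add: t_def)
    finally have "t * q < 2 * (w \<bullet> w)"
      using pos by linarith
    then have "t * (t * q) < t * (2 * (w \<bullet> w))"
      using t by (simp add: mult_strict_left_mono)
    then show False
      using ineq[of t] by (simp add: power2_eq_square algebra_simps)
  qed
  then have "A *v u = l *\<^sub>R u"
    by (simp add: w_def)
  with u that show ?thesis
    by auto
qed

text \<open>The orthogonal complement of a set of eigenvectors is invariant under a symmetric matrix, so as long
  as it is nonzero it contributes a further eigenvector.\<close>

lemma symmetric_matrix_orthonormal_eigenvectors:
  fixes A :: "real^'n^'n"
  assumes sym: "transpose A = A" and "k \<le> CARD('n)"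
  shows "\<exists>B. finite B \<and> card B = k \<and> pairwise orthogonal B \<and>
    (\<forall>b\<in>B. norm b = 1 \<and> (\<exists>l. A *v b = l *\<^sub>R b))"
  using assms(2)
proof (induction k)
  case 0
  show ?case by (intro exI[of _ "{}"]) auto
next
  case (Suc k)
  then obtain B where B: "finite B" "card B = k" "pairwise orthogonal B"
    and eig: "\<And>b. b \<in> B \<Longrightarrow> norm b = 1 \<and> (\<exists>l. A *v b = l *\<^sub>R b)"
    by (metis Suc_leD)
  have "dim B < DIM(real^'n)"
    using dim_le_card[of B B] B Suc.prems by (simp add: span_superset)
  then obtain a where a: "a \<noteq> 0" "\<And>y. y \<in> span B \<Longrightarrow> orthogonal a y"
    by (rule orthogonal_to_subspace_exists) blast
  define S where "S = {x. \<forall>b\<in>B. b \<bullet> x = 0}"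
  have "subspace S"
    unfolding S_def by (auto simp: subspace_def inner_add_right)
  moreover have "A *v x \<in> S" if "x \<in> S" for x
  proof -
    have "b \<bullet> (A *v x) = 0" if "b \<in> B" for b
      using eig[OF that] \<open>x \<in> S\<close> that by (auto simp: symmetric_matrix_inner[OF sym] S_def)
    then show ?thesis by (simp add: S_def)
  qed
  moreover have "a \<in> S"
    using a(2) by (auto simp: S_def span_base orthogonal_def inner_commute)
  ultimately obtain u l where u: "u \<in> S" "norm u = 1" "A *v u = l *\<^sub>R u"
    using symmetric_matrix_eigenvector_in_subspace[OF sym] a(1) by metis
  have "u \<notin> B"
    using u by (auto simp: S_def)
  moreover have "pairwise orthogonal (insert u B)"
    using B u by (auto simp: pairwise_insert S_def orthogonal_def inner_commute)
  ultimately show ?case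
    using B eig u by (intro exI[of _ "insert u B"]) auto
qed

definition diag_matrix :: "('n \<Rightarrow> 'a::zero) \<Rightarrow> 'a^'n^'n" where
  "diag_matrix d = (\<chi> i j. if i = j then d i else 0)"

lemma diag_matrix_mult_vector:
  "diag_matrix d *v (x :: 'a::semiring_1^'n) = (\<chi> i. d i * x $ i)"
  by (simp add: diag_matrix_def matrix_vector_mult_def vec_eq_iff
      if_distrib[of "\<lambda>c. c * _"] cong: if_cong)

text \<open>The diagonal entries are indexed by the index type itself, in no particular order; so a statement
  about two eigenvalues counted with multiplicity is one about two distinct indices.\<close>

definition orthogonally_diagonalizes :: "real^'n^'n \<Rightarrow> ('n \<Rightarrow> real) \<Rightarrow> real^'n^'n \<Rightarrow> bool" where
  "orthogonally_diagonalizes Q d A \<longleftrightarrow>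
     orthogonal_matrix Q \<and> A = Q ** diag_matrix d ** transpose Q"

theorem symmetric_matrix_diagonalization:
  fixes A :: "real^'n^'n"
  assumes sym: "transpose A = A"
  obtains Q d where "orthogonally_diagonalizes Q d A"
proof -
  obtain B where B: "finite B" "card B = CARD('n)" "pairwise orthogonal B"
    and eig: "\<And>b. b \<in> B \<Longrightarrow> norm b = 1 \<and> (\<exists>l. A *v b = l *\<^sub>R b)"
    using symmetric_matrix_orthonormal_eigenvectors[OF sym, of "CARD('n)"] by blast
  obtain e where e: "bij_betw e (UNIV :: 'n set) B"
    using finite_same_card_bij[of "UNIV :: 'n set" B] B by auto
  then have eB: "e i \<in> B" for i
    using bij_betwE by blast
  have e_inj: "e i \<noteq> e j" if "i \<noteq> j" for i j
    using e that by (metis UNIV_I bij_betw_def inj_onD)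
  obtain d where d: "A *v e i = d i *\<^sub>R e i" for i
    using eig[OF eB] by metis
  define Q where "Q = (\<chi> i j. e j $ i)"
  have col: "column j Q = e j" for j
    by (simp add: Q_def column_def vec_eq_iff)
  have orth: "orthogonal_matrix Q"
    unfolding orthogonal_matrix_orthonormal_columns col
    using eig[OF eB] B(3) eB e_inj by (simp add: pairwise_def)
  have "A ** Q = Q ** diag_matrix d"
  proof -
    have "(A ** Q) $ i $ j = (Q ** diag_matrix d) $ i $ j" for i j
    proof -
      have "(A ** Q) $ i $ j = (A *v e j) $ i"
        by (simp add: matrix_matrix_mult_def matrix_vector_mult_def Q_def)
      also have "\<dots> = (Q ** diag_matrix d) $ i $ j"
        by (simp add: d matrix_matrix_mult_def diag_matrix_def Q_def mult.commute if_distrib cong: if_cong)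
      finally show ?thesis .
    qed
    then show ?thesis by (simp add: vec_eq_iff)
  qed
  then have "A = Q ** diag_matrix d ** transpose Q"
    using orth unfolding orthogonal_matrix_def by (metis matrix_mul_assoc matrix_mul_rid)
  with orth that show ?thesis
    by (simp add: orthogonally_diagonalizes_def)
qed

section \<open>Sorted eigenvalues in terms of a diagonalization\<close>

lemma matrix_diff_ldistrib: "(A :: real^'n^'m) ** (B - C) = A ** B - A ** C"
  by (simp add: matrix_matrix_mult_def vec_eq_iff sum_subtractf right_diff_distrib)

lemma matrix_diff_rdistrib: "(A - B :: real^'n^'m) ** C = A ** C - B ** C"
  by (simp add: matrix_matrix_mult_def vec_eq_iff sum_subtractf left_diff_distrib)

lemma mat_mult_matrix: "mat c ** (A :: real^'n^'m) = c *\<^sub>R A"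
  by (simp add: matrix_matrix_mult_def mat_def vec_eq_iff if_distrib[of "\<lambda>c. c * _"] cong: if_cong)

lemma matrix_mult_mat: "(A :: real^'n^'m) ** mat c = c *\<^sub>R A"
  by (simp add: matrix_matrix_mult_def mat_def vec_eq_iff if_distrib mult.commute cong: if_cong)

lemma poly_charpoly: "poly (charpoly A) x = det (mat x - A)"
  unfolding charpoly_def det_def
  by (simp add: poly_sum poly_prod mat_def of_int_poly if_distrib[of "\<lambda>p. poly p x"] cong: if_cong)

lemma charpoly_diagonalized:
  assumes "orthogonally_diagonalizes Q d A"
  shows "charpoly A = (\<Prod>i\<in>UNIV. [:- d i, 1:])"
proof -
  have Q: "Q ** transpose Q = mat 1" and A: "A = Q ** diag_matrix d ** transpose Q"
    using assms by (auto simp: orthogonally_diagonalizes_def orthogonal_matrix_def)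
  have "poly (charpoly A) x = poly (\<Prod>i\<in>UNIV. [:- d i, 1:]) x" for x
  proof -
    have "mat x = Q ** mat x ** transpose Q"
      using Q by (simp add: matrix_mult_mat scalar_matrix_assoc[symmetric])
        (simp add: mat_def vec_eq_iff)
    then have "mat x - A = Q ** (mat x - diag_matrix d) ** transpose Q"
      using A by (simp add: matrix_diff_ldistrib matrix_diff_rdistrib)
    then have "det (mat x - A) = det (Q ** transpose Q) * det (mat x - diag_matrix d)"
      by (simp add: det_mul)
    also have "det (mat x - diag_matrix d) = (\<Prod>i\<in>UNIV. x - d i)"
      by (subst det_diagonal) (auto simp: mat_def diag_matrix_def)
    finally show ?thesis
      by (simp add: poly_charpoly Q poly_prod)
  qed
  then show ?thesis
    by (simp add: poly_eq_poly_eq_iff[symmetric] fun_eq_iff)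
qed

text \<open>The sorted list of the roots of the characteristic polynomial enumerates the diagonal entries along
  some ordering \<open>idx\<close> of the index type.  Knowing the ordering, rather than only the multiset of entries,
  lets two positions of the list be read as two distinct indices even if the eigenvalues coincide.\<close>

lemma eigvals_desc_diagonalized:
  fixes A :: "real^'n^'n"
  assumes "orthogonally_diagonalizes Q d A"
  obtains idx where "distinct idx" "set idx = UNIV" "eigvals_desc A = map d idx"
    "sorted_wrt (\<ge>) (eigvals_desc A)"
proof -
  obtain ks :: "'n list" where ks: "set ks = UNIV" "distinct ks"
    using finite_distinct_list[OF finite] by metis
  have "proots (charpoly A) = (\<Sum>i\<in>UNIV. {#d i#})"
    unfolding charpoly_diagonalized[OF assms] by (subst proots_prod) auto
  also have "\<dots> = mset (map d ks)"
    using ks(2) unfolding ks(1)[symmetric] by (induction ks) auto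
  finally have "eigvals_desc A = rev (sort (map d ks))"
    by (metis eigvals_desc_def sorted_list_of_multiset_mset)
  also have "sort (map d ks) = map d (sort_key d ks)"
    by (rule properties_for_sort) simp_all
  finally have "eigvals_desc A = map d (rev (sort_key d ks))"
    by (simp add: rev_map)
  moreover have "sorted_wrt (\<ge>) (eigvals_desc A)"
    by (simp add: eigvals_desc_def sorted_wrt_rev)
  ultimately show ?thesis
    using that[of "rev (sort_key d ks)"] ks by simp
qed

text \<open>This and the next two lemmas reduce sign conditions on \<open>eigval 1\<close> and on \<open>eigval 1 + eigval 2\<close> to
  conditions on single diagonal entries and on pairs of entries with distinct indices.\<close>

lemma eigval_1_ge:
  assumes "orthogonally_diagonalizes Q d A"
  shows "d i \<le> eigval 1 A"
proof -
  obtain idx where idx: "set idx = UNIV" "eigvals_desc A = map d idx"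
    and sorted: "sorted_wrt (\<ge>) (eigvals_desc A)"
    using eigvals_desc_diagonalized[OF assms] by metis
  obtain p where p: "p < length idx" "idx ! p = i"
    using idx(1) by (metis UNIV_I in_set_conv_nth)
  show ?thesis
    using sorted_wrt_nth_less[OF sorted, of 0 p] p idx by (cases "p = 0") (auto simp: eigval_def)
qed

lemma eigval_1_2_ge:
  assumes "orthogonally_diagonalizes Q d A" and "i \<noteq> j"
  shows "d i + d j \<le> eigval 1 A + eigval 2 A"
proof -
  obtain idx where idx: "set idx = UNIV" "eigvals_desc A = map d idx"
    and sorted: "sorted_wrt (\<ge>) (eigvals_desc A)"
    using eigvals_desc_diagonalized[OF assms(1)] by metis
  have le: "d k \<le> eigval 2 A" if "0 < p" "p < length idx" "idx ! p = k" for p k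
    using sorted_wrt_nth_less[OF sorted, of 1 p] that idx by (cases "p = 1") (auto simp: eigval_def)
  obtain p q where p: "p < length idx" "idx ! p = i" and q: "q < length idx" "idx ! q = j"
    using idx(1) by (metis UNIV_I in_set_conv_nth)
  \<comment> \<open>At most one of the two positions is the first one.\<close>
  have "0 < p \<or> 0 < q"
    using p q assms(2) by (metis not_gr_zero)
  then show ?thesis
    using le p q eigval_1_ge[OF assms(1)] by (metis add.commute add_mono)
qed

lemma S2_attained:
  fixes A :: "real^'n^'n"
  assumes "orthogonally_diagonalizes Q d A" and "CARD('n) \<ge> 2"
  obtains i j where "i \<noteq> j" "S2 A = d i + d j"
proof -
  obtain idx where idx: "distinct idx" "set idx = (UNIV :: 'n set)" "eigvals_desc A = map d idx"
    using eigvals_desc_diagonalized[OF assms(1)] by metis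
  have "0 < length idx" "1 < length idx"
    using distinct_card[OF idx(1)] assms(2) unfolding idx(2) by linarith+
  then have "idx ! 0 \<noteq> idx ! 1" "S2 A = d (idx ! 0) + d (idx ! 1)"
    using idx nth_eq_iff_index_eq[OF idx(1), of 0 1] by (simp_all add: S2_def eigval_def)
  then show ?thesis by (rule that)
qed

section \<open>Sums of a quadratic form over orthonormal pairs\<close>

lemma eigenvector_column:
  assumes "orthogonally_diagonalizes Q d A"
  shows "A *v column i Q = d i *\<^sub>R column i Q"
proof -
  have Q: "transpose Q ** Q = mat 1" and A: "A = Q ** diag_matrix d ** transpose Q"
    using assms by (auto simp: orthogonally_diagonalizes_def orthogonal_matrix_def)
  have "A ** Q = Q ** diag_matrix d"
    unfolding A by (simp add: matrix_mul_assoc[symmetric] Q)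
  then have "A *v column i Q = Q *v (diag_matrix d *v axis i 1)"
    by (metis matrix_vector_mul_assoc matrix_vector_mult_basis)
  also have "diag_matrix d *v axis i 1 = d i *\<^sub>R axis i 1"
    by (simp add: diag_matrix_mult_vector vec_eq_iff axis_def)
  finally show ?thesis
    by (simp add: matrix_vector_mult_scaleR matrix_vector_mult_basis)
qed

text \<open>The left-hand side \<open>s\<close> is the squared length of the projection \<open>p\<close> of the \<open>i\<close>-th basis vector onto the
  plane spanned by \<open>y\<close> and \<open>z\<close>.  It is also the \<open>i\<close>-th component of \<open>p\<close>, so that
  \<open>s\<^sup>2 \<le> |p|\<^sup>2 = s\<close>.\<close>

lemma orthonormal_pair_component_le_1:
  fixes y z :: "real^'n"
  assumes "norm y = 1" "norm z = 1" "y \<bullet> z = 0"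
  shows "(y $ i)\<^sup>2 + (z $ i)\<^sup>2 \<le> 1"
proof -
  define s where "s = (y $ i)\<^sup>2 + (z $ i)\<^sup>2"
  define p where "p = y $ i *\<^sub>R y + z $ i *\<^sub>R z"
  have "y \<bullet> y = 1" "z \<bullet> z = 1" "z \<bullet> y = 0"
    using assms by (simp_all add: dot_square_norm inner_commute)
  then have "p \<bullet> p = s"
    using assms(3) by (simp add: p_def s_def inner_add_left inner_add_right power2_eq_square)
  moreover have "p $ i = s"
    by (simp add: p_def s_def power2_eq_square)
  moreover have "\<bar>p $ i\<bar>\<^sup>2 \<le> (norm p)\<^sup>2"
    by (intro power_mono component_le_norm_cart) simp
  ultimately have "s * s \<le> s * 1"
    by (simp add: dot_square_norm power2_eq_square[of s])
  moreover have "s \<ge> 0"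
    by (simp add: s_def)
  ultimately show ?thesis
    unfolding s_def[symmetric] by (cases "s = 0") auto
qed

text \<open>At most one entry \<open>d k\<close> is nonnegative.  Its weight is at most 1, so weight at least 1 remains for
  the other entries; each of those is below \<open>- d k\<close> and together they outweigh it.  If there is no such
  entry, no term is positive and some term is negative.\<close>

lemma weighted_sum_neg_of_pairwise_neg:
  fixes d w :: "'i::finite \<Rightarrow> real"
  assumes pair: "\<And>i j. i \<noteq> j \<Longrightarrow> d i + d j < 0"
    and w: "\<And>i. 0 \<le> w i" "\<And>i. w i \<le> 1" and total: "(\<Sum>i\<in>UNIV. w i) = 2"
  shows "(\<Sum>i\<in>UNIV. d i * w i) < 0"
proof (cases "\<exists>k. d k \<ge> 0")
  case True
  then obtain k where k: "d k \<ge> 0" ..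
  have less: "d i < - d k" if "i \<noteq> k" for i
    using pair[OF that] by simp
  have split: "(\<Sum>i\<in>UNIV. g i) = g k + (\<Sum>i\<in>UNIV - {k}. g i)" for g :: "'i \<Rightarrow> real"
    by (simp add: sum.remove)
  have rest: "(\<Sum>i\<in>UNIV - {k}. w i) = 2 - w k"
    using split[of w] total by simp
  then have "(\<Sum>i\<in>UNIV - {k}. w i) > 0"
    using w(2)[of k] by simp
  then have "\<not> (\<forall>i\<in>UNIV - {k}. w i \<le> 0)"
    using sum_nonpos[of "UNIV - {k}" w] by auto
  then obtain i where i: "i \<noteq> k" "w i > 0"
    by (auto simp: not_le)
  have "(\<Sum>i\<in>UNIV - {k}. d i * w i) < (\<Sum>i\<in>UNIV - {k}. - d k * w i)"
  proof (rule sum_strict_mono_ex1)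
    show "\<forall>i\<in>UNIV - {k}. d i * w i \<le> - d k * w i"
      using less w(1) by (intro ballI mult_right_mono) (auto intro: less_imp_le)
    show "\<exists>i\<in>UNIV - {k}. d i * w i < - d k * w i"
      using mult_strict_right_mono[OF less[OF i(1)] i(2)] i(1) by blast
  qed simp
  also have "\<dots> = - d k * (2 - w k)"
    by (simp only: sum_distrib_left[symmetric] rest)
  finally have "(\<Sum>i\<in>UNIV. d i * w i) < d k * (2 * (w k - 1))"
    using split[of "\<lambda>i. d i * w i"] by (simp add: algebra_simps)
  also have "\<dots> \<le> 0"
    using k w(2)[of k] by (intro mult_nonneg_nonpos) auto
  finally show ?thesis .
next
  case False
  then have neg: "d j < 0" for j
    by (simp add: not_le)
  have "\<not> (\<forall>i. w i \<le> 0)"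
    using total sum_nonpos[of UNIV w] by auto
  then obtain i where "w i > 0"
    by (auto simp: not_le)
  then have "d i * w i < 0"
    using neg by (simp add: mult_neg_pos)
  moreover have "d j * w j \<le> 0" for j
    using neg[of j] w(1)[of j] by (simp add: mult_nonpos_nonneg)
  ultimately have "(\<Sum>i\<in>UNIV. d i * w i) < (\<Sum>i\<in>(UNIV :: 'i set). 0)"
    by (intro sum_strict_mono_ex1) auto
  then show ?thesis by simp
qed

lemma quadratic_form_diagonalized:
  assumes "orthogonally_diagonalizes Q d A"
  shows "u \<bullet> (A *v u) = (\<Sum>i\<in>UNIV. d i * ((transpose Q *v u) $ i)\<^sup>2)"
proof -
  have "u \<bullet> (A *v u) = u \<bullet> (Q *v (diag_matrix d *v (transpose Q *v u)))"
    using assms by (simp add: orthogonally_diagonalizes_def matrix_vector_mul_assoc matrix_mul_assoc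
        del: transpose_matrix_vector)
  also have "\<dots> = (transpose Q *v u) \<bullet> (diag_matrix d *v (transpose Q *v u))"
    by (simp add: dot_lmul_matrix)
  also have "\<dots> = (\<Sum>i\<in>UNIV. d i * ((transpose Q *v u) $ i)\<^sup>2)"
    by (simp add: inner_vec_def diag_matrix_mult_vector power2_eq_square mult_ac del: transpose_matrix_vector)
  finally show ?thesis .
qed

lemma orthogonal_matrix_inner:
  fixes Q :: "real^'n^'n"
  assumes "orthogonal_matrix Q"
  shows "(transpose Q *v u) \<bullet> (transpose Q *v v) = u \<bullet> v"
proof -
  have "(transpose Q *v u) \<bullet> (transpose Q *v v) = u \<bullet> (Q *v (transpose Q *v v))"
    by (simp add: dot_lmul_matrix)
  also have "\<dots> = u \<bullet> v"
    using assms by (simp add: matrix_vector_mul_assoc orthogonal_matrix_def del: transpose_matrix_vector)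
  finally show ?thesis .
qed

text \<open>One half of the Ky Fan principle, as a statement about signs: the sum of the quadratic form over an orthonormal pair never exceeds
  the sum of the two largest eigenvalues.  In an eigenbasis this sum weights each eigenvalue by
  \<open>(y $ i)\<^sup>2 + (z $ i)\<^sup>2\<close>; the weights are at most 1 and add up to 2.\<close>

lemma trace_on_plane_neg:
  fixes A :: "real^'n^'n"
  assumes diag: "orthogonally_diagonalizes Q d A"
    and pair: "\<And>i j. i \<noteq> j \<Longrightarrow> d i + d j < 0"
    and uv: "norm u = 1" "norm v = 1" "u \<bullet> v = 0"
  shows "u \<bullet> (A *v u) + v \<bullet> (A *v v) < 0"
proof -
  define y z where "y = transpose Q *v u" and "z = transpose Q *v v"
  have Q: "orthogonal_matrix Q"
    using diag by (simp add: orthogonally_diagonalizes_def)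
  have yz: "norm y = 1" "norm z = 1" "y \<bullet> z = 0"
    using uv unfolding y_def z_def norm_eq_sqrt_inner orthogonal_matrix_inner[OF Q] by auto
  have "u \<bullet> (A *v u) + v \<bullet> (A *v v) = (\<Sum>i\<in>UNIV. d i * ((y $ i)\<^sup>2 + (z $ i)\<^sup>2))"
    unfolding quadratic_form_diagonalized[OF diag] y_def z_def
    by (simp add: sum.distrib distrib_left)
  also have "\<dots> < 0"
  proof (rule weighted_sum_neg_of_pairwise_neg[OF pair])
    have "(\<Sum>i\<in>UNIV. (y $ i)\<^sup>2 + (z $ i)\<^sup>2) = y \<bullet> y + z \<bullet> z"
      by (simp add: inner_vec_def sum.distrib power2_eq_square)
    then show "(\<Sum>i\<in>UNIV. (y $ i)\<^sup>2 + (z $ i)\<^sup>2) = 2"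
      using yz by (simp add: dot_square_norm)
    show "(y $ i)\<^sup>2 + (z $ i)\<^sup>2 \<le> 1" for i
      using orthonormal_pair_component_le_1[OF yz] .
  qed auto
  finally show ?thesis .
qed

lemma inner_transpose_mult_vector: "x \<bullet> (transpose A *v x) = x \<bullet> (A *v (x :: real^'n))"
  by (simp add: inner_commute[of x "x v* A"] dot_lmul_matrix)

text \<open>The other half of the Ky Fan principle: the sum of the two largest eigenvalues is the value of the
  quadratic form on a particular orthonormal pair, namely the two eigenvectors.  The form of \<open>M\<close> is half
  the form of its symmetrization.\<close>

lemma S2_neg_if_trace_on_planes_neg:
  fixes M :: "real^'n^'n"
  assumes "CARD('n) \<ge> 2"
    and neg: "\<And>u v. \<lbrakk>norm u = 1; norm v = 1; u \<bullet> v = 0\<rbrakk> \<Longrightarrow> u \<bullet> (M *v u) + v \<bullet> (M *v v) < 0"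
  shows "S2 (M + transpose M) < 0"
proof -
  have "transpose (M + transpose M) = M + transpose M"
    by (simp add: transpose_def vec_eq_iff)
  then obtain Q d where diag: "orthogonally_diagonalizes Q d (M + transpose M)"
    using symmetric_matrix_diagonalization by blast
  obtain i j where ij: "i \<noteq> j" "S2 (M + transpose M) = d i + d j"
    using S2_attained[OF diag assms(1)] .
  have orth: "norm (column k Q) = 1" "k \<noteq> l \<Longrightarrow> column k Q \<bullet> column l Q = 0" for k l
    using diag unfolding orthogonally_diagonalizes_def orthogonal_matrix_orthonormal_columns
    by (auto simp: orthogonal_def)
  have "d k = 2 * (column k Q \<bullet> (M *v column k Q))" for k
  proof -
    have "d k = column k Q \<bullet> ((M + transpose M) *v column k Q)"
      using orth(1)[of k] by (simp add: eigenvector_column[OF diag] dot_square_norm)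
    also have "\<dots> = 2 * (column k Q \<bullet> (M *v column k Q))"
      by (simp add: matrix_vector_mult_add_rdistrib inner_add_right inner_transpose_mult_vector
          del: transpose_matrix_vector)
    finally show ?thesis .
  qed
  then show ?thesis
    using neg[OF orth(1) orth(1) orth(2)[OF ij(1)]] ij(2) by simp
qed

section \<open>Block matrices\<close>

lemma inner_sym_part: "x \<bullet> (sym_part A *v x) = x \<bullet> (A *v x)"
  by (simp add: sym_part_def scaleR_matrix_vector_assoc[symmetric] matrix_vector_mult_add_rdistrib
      inner_add_right inner_transpose_mult_vector del: transpose_matrix_vector)

lemma transpose_sym_part: "transpose (sym_part A) = sym_part A"
  by (simp add: sym_part_def transpose_def vec_eq_iff add.commute)

lemma sum_UNIV_sum: "(\<Sum>k\<in>UNIV. g k) = (\<Sum>i\<in>UNIV. g (Inl i)) + (\<Sum>j\<in>UNIV. g (Inr j))"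
  for g :: "'a::finite + 'b::finite \<Rightarrow> 'c::comm_monoid_add"
  by (simp add: UNIV_Plus_UNIV[symmetric] sum.Plus del: UNIV_Plus_UNIV)

lemma block_matrix_mult:
  "block_matrix A B C D ** block_matrix A' B' C' D' =
   block_matrix (A ** A' + B ** C') (A ** B' + B ** D') (C ** A' + D ** C') (C ** B' + D ** D')"
  by (simp add: vec_eq_iff block_matrix_def matrix_matrix_mult_def sum_UNIV_sum split: sum.split)

lemma transpose_block_matrix:
  "transpose (block_matrix A B C D) = block_matrix (transpose A) (transpose C) (transpose B) (transpose D)"
  by (simp add: vec_eq_iff block_matrix_def transpose_def split: sum.split)

lemma mat_eq_block_matrix: "mat c = block_matrix (mat c) 0 0 (mat c)"
  by (simp add: vec_eq_iff block_matrix_def mat_def split: sum.split)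

lemma diag_matrix_eq_block_matrix:
  "diag_matrix (case_sum d d') = block_matrix (diag_matrix d) 0 0 (diag_matrix d')"
  by (simp add: vec_eq_iff block_matrix_def diag_matrix_def split: sum.split)

lemma sym_part_block_diagonal:
  "sym_part (block_matrix A 0 0 B) = block_matrix (sym_part A) 0 0 (sym_part B)"
  by (simp add: vec_eq_iff block_matrix_def sym_part_def transpose_def split: sum.split)

lemma matrix_mult_0: "(A :: real^'n^'m) ** 0 = 0" "0 ** (A :: real^'n^'m) = 0"
  by (simp_all add: matrix_matrix_mult_def vec_eq_iff)

lemma transpose_0: "transpose (0 :: real^'n^'m) = 0"
  by (simp add: transpose_def vec_eq_iff)

lemma orthogonally_diagonalizes_block:
  assumes "orthogonally_diagonalizes Qa da A" "orthogonally_diagonalizes Qb db B"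
  shows "orthogonally_diagonalizes (block_matrix Qa 0 0 Qb) (case_sum da db) (block_matrix A 0 0 B)"
  using assms
  by (simp add: orthogonally_diagonalizes_def orthogonal_matrix diag_matrix_eq_block_matrix
      transpose_block_matrix block_matrix_mult matrix_mult_0 transpose_0 mat_eq_block_matrix)

lemma matrix_inv_eqI:
  fixes A :: "real^'n^'m"
  assumes "A ** B = mat 1" "B ** A = mat 1"
  shows "matrix_inv A = B"
  unfolding matrix_inv_def
proof (rule some_equality)
  show "C = B" if "A ** C = mat 1 \<and> C ** A = mat 1" for C
    using assms that by (metis matrix_mul_assoc matrix_mul_lid matrix_mul_rid)
qed (use assms in simp)

text \<open>Rescaling the state of the second system by \<open>1 / \<epsilon>\<close> multiplies the coupling block by \<open>\<epsilon>\<close> and changes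
  nothing on the diagonal.  The vanishing lower left block matters: it would be multiplied by \<open>1 / \<epsilon>\<close>.\<close>

lemma block_matrix_scaling_conjugation:
  assumes "\<epsilon> \<noteq> 0"
  defines "\<Theta> \<equiv> block_matrix (mat 1) 0 0 (mat (1 / \<epsilon>)) :: real^('n::finite + 'm::finite)^('n + 'm)"
  shows "invertible \<Theta>"
    and "\<Theta> ** block_matrix A B 0 D ** matrix_inv \<Theta> =
      block_matrix A 0 0 D + \<epsilon> *\<^sub>R block_matrix 0 B 0 0"
proof -
  define \<Theta>' where "\<Theta>' = (block_matrix (mat 1) 0 0 (mat \<epsilon>) :: real^('n + 'm)^('n + 'm))"
  have mat: "mat (1 / \<epsilon>) ** mat \<epsilon> = (mat 1 :: real^'m^'m)" "mat \<epsilon> ** mat (1 / \<epsilon>) = (mat 1 :: real^'m^'m)"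
    using assms(1) by (simp_all add: mat_mult_matrix) (simp_all add: mat_def vec_eq_iff)
  have inv: "\<Theta> ** \<Theta>' = mat 1" "\<Theta>' ** \<Theta> = mat 1"
    by (simp_all add: \<Theta>_def \<Theta>'_def block_matrix_mult matrix_mult_0 mat mat_eq_block_matrix[of 1])
  then show I: "invertible \<Theta>"
    by (auto simp: invertible_def)
  have inv_eq: "matrix_inv \<Theta> = \<Theta>'"
    by (rule matrix_inv_eqI[OF inv])
  have "\<Theta> ** block_matrix A B 0 D ** \<Theta>' = block_matrix A (\<epsilon> *\<^sub>R B) 0 D"
    using assms(1)
    by (simp add: \<Theta>_def \<Theta>'_def block_matrix_mult matrix_mult_0 mat_mult_matrix matrix_mult_mat)
  also have "\<dots> = block_matrix A 0 0 D + \<epsilon> *\<^sub>R block_matrix 0 B 0 0"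
    by (simp add: block_matrix_def vec_eq_iff split: sum.split)
  finally show "\<Theta> ** block_matrix A B 0 D ** matrix_inv \<Theta> =
      block_matrix A 0 0 D + \<epsilon> *\<^sub>R block_matrix 0 B 0 0"
    unfolding inv_eq .
qed

text \<open>The uncoupled interconnection.  Two eigenvalues of the block diagonal symmetric part come both from
  \<open>A\<close>, both from \<open>B\<close>, or one from each block; the three spectral hypotheses cover these cases.\<close>

lemma block_diagonal_trace_on_plane_neg:
  fixes A :: "real^'n^'n" and B :: "real^'m^'m"
  assumes A: "eigval 1 (sym_part A) < 0 \<or> eigval 1 (sym_part A) + eigval 2 (sym_part A) < 0"
    and B: "eigval 1 (sym_part B) < 0 \<or> eigval 1 (sym_part B) + eigval 2 (sym_part B) < 0"
    and AB: "eigval 1 (sym_part A) + eigval 1 (sym_part B) < 0"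
    and uv: "norm u = 1" "norm v = 1" "u \<bullet> v = 0"
  shows "u \<bullet> (block_matrix A 0 0 B *v u) + v \<bullet> (block_matrix A 0 0 B *v v) < 0"
proof -
  obtain Qa da where a: "orthogonally_diagonalizes Qa da (sym_part A)"
    using symmetric_matrix_diagonalization[OF transpose_sym_part] .
  obtain Qb db where b: "orthogonally_diagonalizes Qb db (sym_part B)"
    using symmetric_matrix_diagonalization[OF transpose_sym_part] .
  have da: "da i + da j < 0" if "i \<noteq> j" for i j
    using A eigval_1_ge[OF a, of i] eigval_1_ge[OF a, of j] eigval_1_2_ge[OF a that] by linarith
  have db: "db i + db j < 0" if "i \<noteq> j" for i j
    using B eigval_1_ge[OF b, of i] eigval_1_ge[OF b, of j] eigval_1_2_ge[OF b that] by linarith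
  have dab: "da i + db j < 0" for i j
    using eigval_1_ge[OF a, of i] eigval_1_ge[OF b, of j] AB by linarith
  have "case_sum da db k + case_sum da db l < 0" if "k \<noteq> l" for k l
    using that da db dab by (auto simp: add.commute split: sum.split)
  from trace_on_plane_neg[OF orthogonally_diagonalizes_block[OF a b] this uv]
  show ?thesis
    by (simp add: sym_part_block_diagonal[symmetric] inner_sym_part)
qed

section \<open>Uniformity over a compact set\<close>

text \<open>A strict inequality holds with a margin on a compact set, and so survives a small perturbation, with
  the same \<open>\<epsilon>\<close> at every point.\<close>

lemma compact_uniform_perturbation:
  fixes \<phi> \<psi> :: "'a::topological_space \<Rightarrow> real"
  assumes K: "compact K" and cont: "continuous_on K \<phi>" "continuous_on K \<psi>"
    and neg: "\<And>k. k \<in> K \<Longrightarrow> \<phi> k < 0"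
  obtains \<epsilon> where "\<epsilon> > 0" "\<And>k. k \<in> K \<Longrightarrow> \<phi> k + \<epsilon> * \<psi> k < 0"
proof (cases "K = {}")
  case True
  then show ?thesis using that[of 1] by simp
next
  case False
  obtain a where a: "a \<in> K" "\<And>k. k \<in> K \<Longrightarrow> \<phi> k \<le> \<phi> a"
    using continuous_attains_sup[OF K False cont(1)] by blast
  obtain b where b: "\<And>k. k \<in> K \<Longrightarrow> \<psi> k \<le> \<psi> b"
    using continuous_attains_sup[OF K False cont(2)] by blast
  define \<epsilon> where "\<epsilon> = - \<phi> a / (\<bar>\<psi> b\<bar> + 1)"
  have pos: "\<epsilon> > 0"
    unfolding \<epsilon>_def using neg[OF a(1)] by (intro divide_pos_pos) auto
  have "\<phi> k + \<epsilon> * \<psi> k < 0" if "k \<in> K" for k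
  proof -
    have "\<epsilon> * \<psi> k < \<epsilon> * (\<bar>\<psi> b\<bar> + 1)"
      using b[OF that] pos by (intro mult_strict_left_mono) auto
    also have "\<dots> = - \<phi> a"
      by (simp add: \<epsilon>_def add_nonneg_eq_0_iff)
    finally show ?thesis
      using a(2)[OF that] by simp
  qed
  with pos that show ?thesis by blast
qed

lemma compact_orthonormal_pairs:
  "compact {p :: 'a::euclidean_space \<times> 'a. norm (fst p) = 1 \<and> norm (snd p) = 1 \<and> fst p \<bullet> snd p = 0}"
proof -
  have "compact ((sphere 0 1 \<times> sphere 0 1) \<inter> {p :: 'a \<times> 'a. fst p \<bullet> snd p = 0})"
    by (intro compact_Int_closed compact_Times compact_sphere closed_Collect_eq continuous_intros)
  moreover have "(sphere 0 1 \<times> sphere 0 1) \<inter> {p :: 'a \<times> 'a. fst p \<bullet> snd p = 0} =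
      {p. norm (fst p) = 1 \<and> norm (snd p) = 1 \<and> fst p \<bullet> snd p = 0}"
    by auto
  ultimately show ?thesis by simp
qed

lemma continuous_on_block_matrix:
  fixes A :: "'a::topological_space \<Rightarrow> real^'n^'n" and B :: "'a \<Rightarrow> real^'m^'n"
  assumes "continuous_on S A" "continuous_on S B" "continuous_on S C" "continuous_on S D"
  shows "continuous_on S (\<lambda>x. block_matrix (A x) (B x) (C x) (D x))"
proof -
  have "continuous_on S (\<lambda>x. block_matrix (A x) (B x) (C x) (D x) $ r $ c)" for r c
    using assms by (cases r; cases c) (auto simp: block_matrix_def intro!: continuous_intros)
  then have "continuous_on S (\<lambda>x. \<chi> r c. block_matrix (A x) (B x) (C x) (D x) $ r $ c)"
    by (intro continuous_on_vec_lambda)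
  then show ?thesis by simp
qed

lemma continuous_on_blocks:
  assumes "continuous_on S (\<lambda>x. block_matrix (A x) (B x) (C x) (D x))"
  shows "continuous_on S A" "continuous_on S B" "continuous_on S C" "continuous_on S D"
proof -
  let ?M = "\<lambda>x. block_matrix (A x) (B x) (C x) (D x)"
  have entries: "continuous_on S (\<lambda>x. \<chi> i k. ?M x $ p i $ q k)"
    for p :: "'e::finite \<Rightarrow> _" and q :: "'f::finite \<Rightarrow> _"
    using assms by (intro continuous_intros)
  show "continuous_on S A" "continuous_on S B" "continuous_on S C" "continuous_on S D"
    using entries[of Inl Inl] entries[of Inl Inr] entries[of Inr Inl] entries[of Inr Inr]
    by (simp_all add: block_matrix_def)
qed

lemma continuous_on_quadratic_form:
  fixes M :: "'a::topological_space \<Rightarrow> real^'n^'n"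
  assumes "continuous_on S M" "continuous_on S u"
  shows "continuous_on S (\<lambda>x. u x \<bullet> (M x *v u x))"
  unfolding matrix_vector_mult_def using assms by (intro continuous_intros)

section \<open>Hierarchical interconnections\<close>

theorem theorem3:
  fixes f :: "real^('n::finite + 'm::finite) \<Rightarrow> real^('n + 'm)"
    and U X :: "(real^('n + 'm)) set"
    and Ja :: "real^('n + 'm) \<Rightarrow> real^'n^'n"
    and Jb :: "real^('n + 'm) \<Rightarrow> real^'m^'m"
    and G :: "real^('n + 'm) \<Rightarrow> real^'m^'n"
  assumes "open U" and "X \<subseteq> U" and "C1_on f U"
    and "compact X" and "simply_connected X"
    and "strictly_forward_invariant f U X" and "forward_invariant f U X"
    and hierarchical: "\<forall>x\<in>X. jacobian f (at x) = block_matrix (Ja x) (G x) 0 (Jb x)"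
    and contraction:
      "(CARD('n) \<ge> 2 \<and>
         (\<forall>x\<in>X. eigval 1 (sym_part (Ja x)) + eigval 2 (sym_part (Ja x)) < 0
               \<and> eigval 1 (sym_part (Jb x)) < 0))
       \<or> (CARD('m) \<ge> 2 \<and>
         (\<forall>x\<in>X. eigval 1 (sym_part (Jb x)) + eigval 2 (sym_part (Jb x)) < 0
               \<and> eigval 1 (sym_part (Ja x)) < 0))"
    and cross: "\<forall>x\<in>X. eigval 1 (sym_part (Ja x)) + eigval 1 (sym_part (Jb x)) < 0"
  shows "\<exists>\<Theta> :: real^('n + 'm)^('n + 'm). invertible \<Theta> \<and>
    (\<forall>x\<in>X. S2 (\<Theta> ** jacobian f (at x) ** matrix_inv \<Theta>
                + transpose (\<Theta> ** jacobian f (at x) ** matrix_inv \<Theta>)) < 0)"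
proof -
  let ?D = "\<lambda>x. block_matrix (Ja x) 0 0 (Jb x)"
  let ?N = "\<lambda>x. block_matrix 0 (G x) 0 0 :: real^('n + 'm)^('n + 'm)"
  let ?trace = "\<lambda>M u v. u \<bullet> (M *v u) + v \<bullet> (M *v v) :: real"
  let ?P = "{p :: (real^('n + 'm)) \<times> (real^('n + 'm)). norm (fst p) = 1 \<and> norm (snd p) = 1 \<and> fst p \<bullet> snd p = 0}"
  have "continuous_on X (\<lambda>x. jacobian f (at x))"
    using assms(2,3) continuous_on_subset unfolding C1_on_def by blast
  then have "continuous_on X (\<lambda>x. block_matrix (Ja x) (G x) 0 (Jb x))"
    using hierarchical by (auto cong: continuous_on_cong)
  note blocks = continuous_on_blocks[OF this]
  have fst: "continuous_on (X \<times> ?P) (\<lambda>k. M (fst k))" if "continuous_on X M"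
    for M :: "real^('n + 'm) \<Rightarrow> real^('n + 'm)^('n + 'm)"
    by (rule continuous_on_compose2[OF that]) (auto intro: continuous_intros)
  have cont: "continuous_on (X \<times> ?P) (\<lambda>k. ?trace (M (fst k)) (fst (snd k)) (snd (snd k)))"
    if "continuous_on X M" for M
    by (intro continuous_on_add continuous_on_quadratic_form fst[OF that] continuous_intros)
  \<comment> \<open>Whichever system is contracting has \<open>eigval 1 < 0\<close>, the weakly contracting one has
      \<open>eigval 1 + eigval 2 < 0\<close>; either is enough for a pair of eigenvalues of the same block.\<close>
  have neg: "?trace (?D x) u v < 0" if "x \<in> X" "norm u = 1" "norm v = 1" "u \<bullet> v = 0" for x u v
    using contraction cross that by (intro block_diagonal_trace_on_plane_neg) auto
  \<comment> \<open>Compactness is used for points and orthonormal pairs jointly: the margin below zero is then uniform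
      in \<open>x\<close>, and continuity is asked of quadratic forms instead of eigenvalues.\<close>
  have comp: "compact (X \<times> ?P)"
    by (intro compact_Times compact_orthonormal_pairs \<open>compact X\<close>)
  have contD: "continuous_on (X \<times> ?P) (\<lambda>k. ?trace (?D (fst k)) (fst (snd k)) (snd (snd k)))"
    and contN: "continuous_on (X \<times> ?P) (\<lambda>k. ?trace (?N (fst k)) (fst (snd k)) (snd (snd k)))"
    by (intro cont continuous_on_block_matrix blocks continuous_on_const)+
  have negK: "?trace (?D (fst k)) (fst (snd k)) (snd (snd k)) < 0" if "k \<in> X \<times> ?P" for k
    using that by (intro neg) auto
  obtain \<epsilon> where eps: "\<epsilon> > 0"
    and less: "\<And>k. k \<in> X \<times> ?P \<Longrightarrow> ?trace (?D (fst k)) (fst (snd k)) (snd (snd k))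
      + \<epsilon> * ?trace (?N (fst k)) (fst (snd k)) (snd (snd k)) < 0"
    using compact_uniform_perturbation[OF comp contD contN negK] by blast
  define \<Theta> :: "real^('n + 'm)^('n + 'm)" where "\<Theta> = block_matrix (mat 1) 0 0 (mat (1 / \<epsilon>))"
  have "CARD('n + 'm) = CARD('n) + CARD('m)"
    using card_Plus[of "UNIV :: 'n set" "UNIV :: 'm set"] by simp
  moreover have "CARD('n) > 0" "CARD('m) > 0"
    by simp_all
  ultimately have card: "CARD('n + 'm) \<ge> 2"
    by linarith
  have "S2 (\<Theta> ** jacobian f (at x) ** matrix_inv \<Theta>
      + transpose (\<Theta> ** jacobian f (at x) ** matrix_inv \<Theta>)) < 0" if x: "x \<in> X" for x
  proof (rule S2_neg_if_trace_on_planes_neg[OF card])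
    fix u v :: "real^('n + 'm)"
    assume uv: "norm u = 1" "norm v = 1" "u \<bullet> v = 0"
    have "\<Theta> ** jacobian f (at x) ** matrix_inv \<Theta> = ?D x + \<epsilon> *\<^sub>R ?N x"
      using hierarchical x eps by (simp add: \<Theta>_def block_matrix_scaling_conjugation(2))
    then have "?trace (\<Theta> ** jacobian f (at x) ** matrix_inv \<Theta>) u v = ?trace (?D x) u v + \<epsilon> * ?trace (?N x) u v"
      by (simp add: matrix_vector_mult_add_rdistrib scaleR_matrix_vector_assoc[symmetric] inner_add_right distrib_left)
    also have "\<dots> < 0"
      using less[of "(x, u, v)"] x uv by simp
    finally show "?trace (\<Theta> ** jacobian f (at x) ** matrix_inv \<Theta>) u v < 0" .
  qed
  moreover have "invertible \<Theta>"
    unfolding \<Theta>_def using eps by (intro block_matrix_scaling_conjugation(1)) simp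
  ultimately show ?thesis
    by blast
qed

end
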